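(* Let $X$ be a non-negative absolutely continuous random variable with bounded support, mean $\mu$ and variance $\sigma^2$, $\sigma>0$, whose distribution is symmetric about $\mu$. Then the cumulative residual entropy of $X$ satisfies $$\mathcal{E}(X)\leq \frac{\sigma}{2}\sum_{n=1}^{+\infty}\frac{c(n+1)}{n},$$ where, for every integer $n\geq 1$, $$c(n)=\left[\frac{2\left(1-\frac{1}{\binom{2n-2}{n-1}}\right)}{2n-1}\right]^{\frac12}.$$
   Context: $\log$ is the natural logarithm, with the convention $0\log 0=0$. The cumulative residual entropy of a non-negative absolutely continuous random variable $X$ with cumulative distribution function $F$ is $\mathcal{E}(X)=-\int_0^{+\infty}(1-F(x))\log(1-F(x))\,dx$. The distribution of $X$ is symmetric about $\mu$ if $X-\mu$ and $\mu-X$ have the same distribution. *)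

theory Defs
  imports "HOL-Probability.Probability"
begin

text \<open>Topological support: the complement of the largest open null set.\<close>

definition measure_support :: "real measure \<Rightarrow> real set" where
  "measure_support N = {x. \<forall>U. open U \<longrightarrow> x \<in> U \<longrightarrow> emeasure N U > 0}"

text \<open>The convention \<open>0 log 0 = 0\<close> holds automatically because of the factor \<open>0\<close>.\<close>

definition cumulative_residual_entropy :: "'a measure \<Rightarrow> ('a \<Rightarrow> real) \<Rightarrow> real" where
  "cumulative_residual_entropy M X =
     - (LBINT x:{0..}. (1 - cdf (distr M borel X) x) * ln (1 - cdf (distr M borel X) x))"

definition symmetric_about :: "'a measure \<Rightarrow> ('a \<Rightarrow> real) \<Rightarrow> real \<Rightarrow> bool" where
  "symmetric_about M X m \<longleftrightarrow>
     distr M borel (\<lambda>\<omega>. X \<omega> - m) = distr M borel (\<lambda>\<omega>. m - X \<omega>)"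

text \<open>Only meant for \<open>n \<ge> 1\<close>, where the subtractions on naturals do not truncate.\<close>

definition c :: "nat \<Rightarrow> real" where
  "c n = sqrt (2 * (1 - 1 / real ((2 * n - 2) choose (n - 1))) / real (2 * n - 1))"

text \<open>The series in the bound converges, so its \<open>suminf\<close> is a genuine sum.\<close>

lemma summable_c: "summable (\<lambda>k. c (Suc k + 1) / real (Suc k))"
proof (rule summable_comparison_test')
  have "summable (\<lambda>k. real k powr (-(3/2)))"
    by (simp add: summable_real_powr_iff)
  then show "summable (\<lambda>k. real (Suc k) powr (-(3/2)))"
    by (subst summable_Suc_iff)
  fix k :: nat
  let ?b = "real ((2 * (Suc k + 1) - 2) choose (Suc k + 1 - 1))"
  have "((2 * (Suc k + 1) - 2) choose (Suc k + 1 - 1)) > 0"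
    by (simp add: zero_less_binomial)
  then have b: "1 \<le> ?b" by linarith
  have "2 * (1 - 1 / ?b) / real (2 * (Suc k + 1) - 1) \<le> 2 / real (2 * Suc k)"
    by (rule frac_le) (use b in auto)
  also have "\<dots> = 1 / real (Suc k)" by (simp add: field_simps)
  finally have "c (Suc k + 1) \<le> sqrt (1 / real (Suc k))"
    unfolding c_def by (rule real_sqrt_le_mono)
  also have "\<dots> = real (Suc k) powr (-(1/2))"
    by (simp add: powr_minus powr_half_sqrt real_sqrt_divide inverse_eq_divide)
  finally have "c (Suc k + 1) / real (Suc k) \<le> real (Suc k) powr (-(1/2)) / real (Suc k)"
    by (rule divide_right_mono) simp
  also have "\<dots> = real (Suc k) powr (-(1/2) - 1)"
    by (simp only: powr_diff) simp
  finally have "c (Suc k + 1) / real (Suc k) \<le> real (Suc k) powr (-(3/2))" by simp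
  moreover have "0 \<le> c (Suc k + 1)"
    unfolding c_def using b by (intro real_sqrt_ge_zero divide_nonneg_nonneg mult_nonneg_nonneg) auto
  ultimately show "norm (c (Suc k + 1) / real (Suc k)) \<le> real (Suc k) powr (-(3/2))"
    by simp
qed

end

theory Submission
  imports Defs
begin

text \<open>
  Write \<open>F\<close> for the distribution function, \<open>Q\<close> for the quantile function and \<open>b = 2 \<mu>\<close>. Symmetry
  about \<open>\<mu>\<close> and nonnegativity force \<open>X\<close> to lie in \<open>[0, b]\<close>, so all integrals below run over a
  bounded interval.

  The entropy integrand is a series with nonnegative terms (\<open>entropy_series\<close>):
  \<open>- (1 - F) ln (1 - F)\<close> is the sum of \<open>(F - F ^ (n + 1)) / (n (n + 1))\<close> over \<open>n \<ge> 1\<close>. It is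
  integrated term by term (\<open>entropy_sums\<close>), so it is enough to show, for each \<open>n\<close>, that the
  integral of \<open>F - F ^ (n + 1)\<close> is at most \<open>(n + 1) (\<sigma> / 2) c(n + 1)\<close>
  (\<open>integral_cdf_gap_le\<close>). Probabilistically that integral is the amount by which the expected
  maximum of \<open>n + 1\<close> independent copies of \<open>X\<close> exceeds \<open>\<mu>\<close>.

  Symmetry says \<open>F (b - x) = 1 - F x\<close>. Averaging the integrand with its reflection replaces it by
  half of \<open>1 - F ^ (n + 1) - (1 - F) ^ (n + 1)\<close>, which equals \<open>n + 1\<close> times the integral of
  \<open>u ^ n - (1 - u) ^ n\<close> over \<open>u\<close> from \<open>F x\<close> to \<open>1\<close>. Exchanging the two integrations
  (\<open>integral_tail_eq_quantile\<close>) turns the integral over \<open>x\<close> into that of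
  \<open>(u ^ n - (1 - u) ^ n) Q u\<close> over \<open>(0, 1)\<close>. Here \<open>Q u\<close> may be replaced by \<open>Q u - \<mu>\<close>,
  whose norm in \<open>L\<^sup>2\<close> is \<open>\<sigma>\<close> because \<open>Q\<close> of a uniform variable is distributed like \<open>X\<close>. The
  norm of the other factor is \<open>c(n + 1)\<close> (\<open>integral_square_difference_eq_c\<close>), and the
  Cauchy-Schwarz inequality gives the bound.
\<close>

section \<open>The entropy integrand as a series\<close>

lemma sums_inverse_consecutive: "(\<lambda>k. 1 / (real (k + 1) * real (k + 2))) sums 1"
proof -
  have "(\<lambda>k. 1 / real (k + 1)) \<longlonglongrightarrow> 0"
    using LIMSEQ_inverse_real_of_nat by (simp add: inverse_eq_divide)
  from telescope_sums'[OF this]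
  have "(\<lambda>k. 1 / real (k + 1) - 1 / real (k + 2)) sums 1" by simp
  moreover have "1 / real (k + 1) - 1 / real (k + 2) = 1 / (real (k + 1) * real (k + 2))" for k
    by (simp add: divide_simps)
  ultimately show ?thesis by simp
qed

text \<open>
  Expanding only the logarithm would give terms \<open>t ^ n * (1 - t) / n\<close>. Summation by parts turns
  them into these terms, in which \<open>t\<close> occurs as \<open>t - t ^ m\<close>: once \<open>t\<close> is a distribution
  function, the integral of that is a centred mean of a maximum, to which the bound by the
  variance applies. All terms are nonnegative on \<open>[0, 1]\<close>, so that the series can be integrated
  term by term.
\<close>

lemma entropy_series:
  fixes t :: real
  assumes "0 \<le> t" "t \<le> 1"
  shows "(\<lambda>k. (t - t ^ (k + 2)) / (real (k + 1) * real (k + 2))) sums - ((1 - t) * ln (1 - t))"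
proof (cases "t = 1")
  case True
  then show ?thesis by simp
next
  case False
  define L where "L = - ln (1 - t)"
  have "(\<lambda>n. - (- (t ^ n) / real n)) sums - ln (1 - t)"
    using assms False ln_series'[of "- t"] by (intro sums_minus) simp
  then have "(\<lambda>n. t ^ n / real n) sums L"
    by (simp add: L_def)
  then have 1: "(\<lambda>n. t ^ (n + 1) / real (n + 1)) sums L"
    using sums_iff_shift[of "\<lambda>n. t ^ n / real n" 1 L] by simp
  then have 2: "(\<lambda>n. t ^ (n + 2) / real (n + 2)) sums (L - t)"
    using sums_iff_shift[of "\<lambda>n. t ^ (n + 1) / real (n + 1)" 1 "L - t"] by (simp add: add.commute)
  have "(\<lambda>k. t * (1 / (real (k + 1) * real (k + 2))) - t * (t ^ (k + 1) / real (k + 1))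
           + t ^ (k + 2) / real (k + 2)) sums (t * 1 - t * L + (L - t))"
    by (intro sums_add sums_diff sums_mult sums_inverse_consecutive 1 2)
  moreover have "t * (1 / (real (k + 1) * real (k + 2))) - t * (t ^ (k + 1) / real (k + 1))
           + t ^ (k + 2) / real (k + 2) = (t - t ^ (k + 2)) / (real (k + 1) * real (k + 2))" for k
    by (simp add: divide_simps) (simp add: algebra_simps)
  ultimately show ?thesis
    by (simp add: L_def algebra_simps)
qed

section \<open>Integrals over the unit interval\<close>

lemma Cauchy_Schwarz_integral:
  fixes f g :: "'a \<Rightarrow> real"
  assumes "s > 0" "t > 0"
    and "integrable M (\<lambda>x. (f x)\<^sup>2)" "(\<integral>x. (f x)\<^sup>2 \<partial>M) = s\<^sup>2"
    and "integrable M (\<lambda>x. (g x)\<^sup>2)" "(\<integral>x. (g x)\<^sup>2 \<partial>M) = t\<^sup>2"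
    and "integrable M (\<lambda>x. f x * g x)"
  shows "(\<integral>x. f x * g x \<partial>M) \<le> s * t"
proof -
  \<comment> \<open>The weighted arithmetic-geometric mean inequality, with the weight that is optimal for norms
    \<open>s\<close> and \<open>t\<close>.\<close>
  have "f x * g x \<le> t / (2 * s) * (f x)\<^sup>2 + s / (2 * t) * (g x)\<^sup>2" for x
  proof -
    have "0 \<le> (t * f x - s * g x)\<^sup>2 / (2 * s * t)"
      using assms by simp
    also have "\<dots> = t / (2 * s) * (f x)\<^sup>2 + s / (2 * t) * (g x)\<^sup>2 - f x * g x"
      using assms by (simp add: field_simps power2_eq_square)
    finally show ?thesis by simp
  qed
  then have "(\<integral>x. f x * g x \<partial>M) \<le> (\<integral>x. t / (2 * s) * (f x)\<^sup>2 + s / (2 * t) * (g x)\<^sup>2 \<partial>M)"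
    using assms by (intro integral_mono) auto
  also have "\<dots> = t / (2 * s) * s\<^sup>2 + s / (2 * t) * t\<^sup>2"
    using assms by simp
  also have "\<dots> = s * t"
    using assms by (simp add: field_simps power2_eq_square)
  finally show ?thesis .
qed

text \<open>
  The open interval, because a quantile function may be infinite at \<open>0\<close> and \<open>1\<close>. The
  quantile function of a distribution, as a random variable on this space, has that distribution.
\<close>

abbreviation unit_uniform :: "real measure" where
  "unit_uniform \<equiv> restrict_space lborel {0<..<1}"

lemma prob_space_unit_uniform: "prob_space unit_uniform"
  by (rule prob_space_restrict_space) auto

lemma unit_uniform_integral_eq:
  fixes f :: "real \<Rightarrow> real"
  assumes "continuous_on {0..1} f" "(f has_integral I) {0..1}"
  shows "(\<integral>u. f u \<partial>unit_uniform) = I"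
proof -
  have int: "set_integrable lborel {0..1} f"
    by (rule borel_integrable_atLeastAtMost'[OF assms(1)])
  have "(\<integral>u. f u \<partial>unit_uniform) = (LINT u:{0<..<1}|lborel. f u)"
    by (simp add: integral_restrict_space set_lebesgue_integral_def)
  also have "\<dots> = integral {0<..<1} f"
    by (intro set_borel_integral_eq_integral set_integrable_subset[OF int]) auto
  also have "\<dots> = I"
    using assms(2) by (simp add: integral_open_interval_real[symmetric] integral_unique)
  finally show ?thesis .
qed

text \<open>
  Writes a function of a number \<open>t\<close> as an average over the threshold \<open>u > t\<close>. With \<open>t\<close> the value
  of a distribution function, the threshold condition can be moved over to the quantile function.
\<close>

lemma unit_uniform_tail_integral:
  fixes f G :: "real \<Rightarrow> real"
  assumes t: "0 \<le> t" "t \<le> 1"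
    and deriv: "\<And>u. (G has_real_derivative f u) (at u)"
    and cont: "continuous_on {0..1} f"
  shows "(\<integral>u. indicator {t<..} u * f u \<partial>unit_uniform) = G 1 - G t"
proof -
  have "(\<integral>u. indicator {t<..} u * f u \<partial>unit_uniform)
      = (\<integral>u. indicator {0<..<1} u * (indicator {t<..} u * f u) \<partial>lborel)"
    by (simp add: integral_restrict_space)
  also have "\<dots> = (\<integral>u. indicator {t..1} u *\<^sub>R f u \<partial>lborel)"
  proof (rule integral_cong_AE)
    have "f \<in> borel_measurable (restrict_space borel {0..1})"
      using cont by (rule borel_measurable_continuous_on_restrict)
    then have m: "(\<lambda>u. indicator {0..1} u *\<^sub>R f u) \<in> borel_measurable borel"
      by (subst (asm) borel_measurable_restrict_space_iff) auto
    \<comment> \<open>Nothing is known about \<open>f\<close> outside \<open>[0, 1]\<close>, so measurability is derived for its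
      restriction.\<close>
    have e1: "(\<lambda>u. indicator {0<..<1} u * (indicator {t<..} u * f u))
       = (\<lambda>u. indicator ({0<..<1} \<inter> {t<..}) u * (indicator {0..1} u *\<^sub>R f u))"
     and e2: "(\<lambda>u. indicator {t..1} u *\<^sub>R f u)
       = (\<lambda>u. indicator {t..1} u * (indicator {0..1} u *\<^sub>R f u))"
      using t by (auto simp: fun_eq_iff split: split_indicator)
    show "(\<lambda>u. indicator {0<..<1} u * (indicator {t<..} u * f u)) \<in> borel_measurable lborel"
      unfolding e1 using m by measurable
    show "(\<lambda>u. indicator {t..1} u *\<^sub>R f u) \<in> borel_measurable lborel"
      unfolding e2 using m by measurable
    show "AE u in lborel. indicator {0<..<1} u * (indicator {t<..} u * f u) = indicator {t..1} u *\<^sub>R f u"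
      using AE_lborel_singleton[of t] AE_lborel_singleton[of 1]
      by eventually_elim (use t in \<open>auto split: split_indicator\<close>)
  qed
  also have "\<dots> = G 1 - G t"
  proof (rule integral_FTC_atLeastAtMost)
    show "(G has_vector_derivative f u) (at u within {t..1})" for u
      using deriv[of u]
      by (simp add: has_real_derivative_iff_has_vector_derivative has_vector_derivative_at_within)
    show "continuous_on {t..1} f"
      using cont t by (auto intro: continuous_on_subset)
  qed (use t in auto)
  finally show ?thesis .
qed

text \<open>
  The Beta integral \<open>B(n + 1, n + 1)\<close>. The case \<open>n = 0\<close> is excluded because the real power
  \<open>0 powr 0\<close> is \<open>0\<close>, so that the real powers in the definition of the Beta integral differ there
  from the natural ones.
\<close>

lemma has_integral_Beta_central:
  assumes "n > 0"
  shows "((\<lambda>u::real. u ^ n * (1 - u) ^ n) has_integral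
            1 / (real (2 * n + 1) * real ((2 * n) choose n))) {0..1}"
proof -
  have "((\<lambda>u. u powr (real (n + 1) - 1) * (1 - u) powr (real (n + 1) - 1)) has_integral
          Beta (real (n + 1)) (real (n + 1))) {0..1}"
    by (rule has_integral_Beta_real) auto
  moreover have "Beta (real (n + 1)) (real (n + 1)) = 1 / (real (2 * n + 1) * real ((2 * n) choose n))"
  proof -
    have 1: "Gamma (real (n + 1)) = fact n"
      using Gamma_fact[of n, where 'a = real] by (simp add: add.commute)
    have "real (n + 1) + real (n + 1) = 1 + real (2 * n + 1)" by simp
    then have 2: "Gamma (real (n + 1) + real (n + 1)) = fact (2 * n + 1)"
      by (simp only: Gamma_fact)
    have 3: "real ((2 * n) choose n) = fact (2 * n) / (fact n * fact n)"
      by (subst binomial_fact) (auto simp: mult_2)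
    show ?thesis
      unfolding Beta_def 1 2 3 by (simp add: field_simps)
  qed
  ultimately have "((\<lambda>u. u powr (real (n + 1) - 1) * (1 - u) powr (real (n + 1) - 1)) has_integral
            1 / (real (2 * n + 1) * real ((2 * n) choose n))) {0..1}"
    by (simp only:)
  then show ?thesis
  proof (rule has_integral_eq[rotated])
    fix u :: real assume "u \<in> {0..1}"
    moreover have "real (n + 1) - 1 = real n" by simp
    ultimately show "u powr (real (n + 1) - 1) * (1 - u) powr (real (n + 1) - 1) = u ^ n * (1 - u) ^ n"
      using assms by (simp only: powr_realpow' atLeastAtMost_iff diff_ge_0_iff_ge)
  qed
qed

text \<open>
  This is where the constants \<open>c\<close> come from: both pure squares integrate to \<open>1 / (2 n + 1)\<close>, and the
  mixed term is a Beta integral and contributes the central binomial coefficient.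
\<close>

lemma integral_square_difference_eq_c:
  assumes "n > 0"
  shows "(\<integral>u. (u ^ n - (1 - u) ^ n)\<^sup>2 \<partial>unit_uniform) = (c (n + 1))\<^sup>2"
proof (rule unit_uniform_integral_eq)
  have pow: "((\<lambda>u::real. u ^ (2 * n)) has_integral 1 / real (2 * n + 1)) {0..1}"
  proof -
    have "((\<lambda>u::real. u ^ (2 * n + 1) / real (2 * n + 1)) has_vector_derivative x ^ (2 * n)) (at x within {0..1})" for x :: real
      unfolding has_real_derivative_iff_has_vector_derivative[symmetric]
      by (rule derivative_eq_intros refl | simp del: of_nat_Suc of_nat_add)+
    from fundamental_theorem_of_calculus[OF _ this] show ?thesis by simp
  qed
  have pow': "((\<lambda>u::real. (1 - u) ^ (2 * n)) has_integral 1 / real (2 * n + 1)) {0..1}"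
  proof -
    have "((\<lambda>u::real. - ((1 - u) ^ (2 * n + 1) / real (2 * n + 1))) has_vector_derivative (1 - x) ^ (2 * n)) (at x within {0..1})" for x :: real
      unfolding has_real_derivative_iff_has_vector_derivative[symmetric]
      by (rule derivative_eq_intros refl | simp del: of_nat_Suc of_nat_add)+
    from fundamental_theorem_of_calculus[OF _ this] show ?thesis by simp
  qed
  define B where "B = real ((2 * n) choose n)"
  have B: "B \<ge> 1"
    unfolding B_def using zero_less_binomial[of n "2 * n"] by linarith
  have "((\<lambda>u::real. u ^ (2 * n) + (1 - u) ^ (2 * n) - 2 * (u ^ n * (1 - u) ^ n)) has_integral
           1 / real (2 * n + 1) + 1 / real (2 * n + 1) - 2 * (1 / (real (2 * n + 1) * B))) {0..1}"
    unfolding B_def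
    by (intro has_integral_add has_integral_diff has_integral_mult_right pow pow' has_integral_Beta_central assms)
  moreover have "(\<lambda>u::real. u ^ (2 * n) + (1 - u) ^ (2 * n) - 2 * (u ^ n * (1 - u) ^ n))
      = (\<lambda>u. (u ^ n - (1 - u) ^ n)\<^sup>2)"
    by (simp add: fun_eq_iff power2_diff power_mult[symmetric] mult.commute mult.left_commute)
  moreover have "1 / real (2 * n + 1) + 1 / real (2 * n + 1) - 2 * (1 / (real (2 * n + 1) * B)) = (c (n + 1))\<^sup>2"
  proof -
    have eq: "c (n + 1) = sqrt (2 * (1 - 1 / B) / real (2 * n + 1))"
      by (simp add: c_def B_def)
    have "(c (n + 1))\<^sup>2 = 2 * (1 - 1 / B) / real (2 * n + 1)"
      unfolding eq using B by (intro real_sqrt_pow2 divide_nonneg_nonneg mult_nonneg_nonneg) auto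
    then show ?thesis using B by (simp add: divide_simps) (simp add: algebra_simps)
  qed
  ultimately show "((\<lambda>u. (u ^ n - (1 - u) ^ n)\<^sup>2) has_integral (c (n + 1))\<^sup>2) {0..1}"
    by simp
qed (intro continuous_intros)

lemma c_pos:
  assumes "n \<ge> 2"
  shows "c n > 0"
proof -
  define m where "m = n - 1"
  have m: "m > 0" "n = m + 1" using assms by (auto simp: m_def)
  have "2 * m \<le> (2 * m) choose m"
  proof -
    have "(2*m) choose 1 \<le> (2 * m) choose m"
      using binomial_mono[of 1 m "2*m"] m by auto
    then show ?thesis by simp
  qed
  then have "real ((2 * m) choose m) \<ge> 2" using m by linarith
  then have "1 / real ((2 * m) choose m) < 1" by simp
  then show ?thesis
    unfolding c_def m(2) by (intro real_sqrt_gt_zero divide_pos_pos mult_pos_pos) auto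
qed

section \<open>Distribution functions and quantile functions\<close>

context cdf_distribution
begin

lemma quantile_bounds:
  assumes "\<And>x. x < 0 \<Longrightarrow> C x = 0" "C b = 1" "0 < u" "u < 1"
  shows "0 \<le> I u" "I u \<le> b"
  using assms pseudoinverse[of u "I u"] pseudoinverse[of u b] by (force simp: not_less[symmetric])+

lemma measurable_quantile [measurable]: "I \<in> borel_measurable unit_uniform"
  using measurable_CI by (simp cong: measurable_cong_sets sets_restrict_space_cong)

text \<open>
  Both sides are the integral of \<open>g u\<close> over the region \<open>C x < u\<close> of the rectangle
  \<open>[0, b] \<times> (0, 1)\<close>. For fixed \<open>u\<close> this region is the interval from \<open>0\<close> to the
  quantile \<open>I u\<close>, because \<open>u \<le> C x\<close> holds exactly if \<open>I u \<le> x\<close>.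
\<close>

lemma integral_tail_eq_quantile:
  fixes g :: "real \<Rightarrow> real"
  assumes supp: "\<And>x. x < 0 \<Longrightarrow> C x = 0" "C b = 1"
    and cont: "continuous_on {0..1} g"
  shows "(LBINT x:{0..b}. (\<integral>u. indicator {C x<..} u * g u \<partial>unit_uniform)) =
         (\<integral>u. g u * I u \<partial>unit_uniform)"
proof -
  let ?A = "restrict_space lborel {0..b}"
  interpret A: finite_measure ?A
    by (rule finite_measureI) (cases "0 \<le> b"; simp add: space_restrict_space emeasure_restrict_space)
  interpret U: prob_space unit_uniform by (rule prob_space_unit_uniform)
  interpret AU: pair_sigma_finite ?A unit_uniform ..
  interpret AU: finite_measure "?A \<Otimes>\<^sub>M unit_uniform"
    by (rule finite_measure_pair_measure) unfold_locales
  have "g \<in> borel_measurable (restrict_space borel {0<..<1})"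
    using cont by (intro borel_measurable_continuous_on_restrict) (auto intro: continuous_on_subset)
  then have g [measurable]: "g \<in> borel_measurable unit_uniform"
    by (simp cong: measurable_cong_sets sets_restrict_space_cong)
  obtain K where K: "\<And>u. 0 \<le> u \<Longrightarrow> u \<le> 1 \<Longrightarrow> \<bar>g u\<bar> \<le> K"
    using compact_imp_bounded[OF compact_continuous_image[OF cont compact_Icc]]
    unfolding bounded_iff by (metis atLeastAtMost_iff imageI real_norm_def)
  have [measurable]: "(\<lambda>x. x) \<in> borel_measurable ?A" "(\<lambda>x. x) \<in> borel_measurable unit_uniform"
    by (simp_all add: measurable_restrict_space1)
  have "integrable (?A \<Otimes>\<^sub>M unit_uniform) (\<lambda>(x, u). indicator {C x<..} u * g u)"
  proof (rule AU.integrable_const_bound)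
    show "AE z in ?A \<Otimes>\<^sub>M unit_uniform. norm (case z of (x, u) \<Rightarrow> indicator {C x<..} u * g u) \<le> K"
    proof (rule AE_I2)
      fix z assume "z \<in> space (?A \<Otimes>\<^sub>M unit_uniform)"
      then have "\<bar>g (snd z)\<bar> \<le> K" 
        by (intro K) (auto simp: space_pair_measure space_restrict_space)
      then show "norm (case z of (x, u) \<Rightarrow> indicator {C x<..} u * g u) \<le> K"
        by (cases z) (auto simp: indicator_def)
    qed
    have "(\<lambda>z. if C (fst z) < snd z then g (snd z) else 0) \<in> borel_measurable (?A \<Otimes>\<^sub>M unit_uniform)"
      by measurable
    also have "(\<lambda>z. if C (fst z) < snd z then g (snd z) else 0) = (\<lambda>(x, u). indicator {C x<..} u * g u)"
      by (auto simp: fun_eq_iff)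
    finally show "(\<lambda>(x, u). indicator {C x<..} u * g u) \<in> borel_measurable (?A \<Otimes>\<^sub>M unit_uniform)" .
  qed
  from AU.Fubini_integral[OF this]
  have "(\<integral>x. (\<integral>u. indicator {C x<..} u * g u \<partial>unit_uniform) \<partial>?A)
      = (\<integral>u. (\<integral>x. indicator {C x<..} u * g u \<partial>?A) \<partial>unit_uniform)" ..
  also have "\<dots> = (\<integral>u. g u * I u \<partial>unit_uniform)"
  proof (rule Bochner_Integration.integral_cong)
    show "(\<integral>x. indicator {C x<..} u * g u \<partial>?A) = g u * I u" if "u \<in> space unit_uniform" for u
    proof -
      from that have u: "0 < u" "u < 1" by (auto simp: space_restrict_space)
      note q = quantile_bounds[OF supp u]
      have "(\<integral>x. indicator {C x<..} u * g u \<partial>?A) = (\<integral>x. indicator {0..<I u} x * g u \<partial>lborel)"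
      proof (subst integral_restrict_space)
        have "indicator {0..b} x * indicator {C x<..} u = (indicator {0..<I u} x :: real)" for x
          using q pseudoinverse[OF u, of x] by (cases "I u \<le> x") (auto simp: indicator_def)
        then show "(\<integral>x. indicator {0..b} x *\<^sub>R (indicator {C x<..} u * g u) \<partial>lborel)
            = (\<integral>x. indicator {0..<I u} x * g u \<partial>lborel)"
          by (simp add: mult.assoc[symmetric])
      qed simp
      also have "\<dots> = g u * I u" using q by simp
      finally show ?thesis .
    qed
  qed simp
  finally show ?thesis
    by (simp add: set_lebesgue_integral_def integral_restrict_space)
qed

lemma set_integrable_cdf:
  fixes h :: "real \<Rightarrow> real"
  assumes "continuous_on UNIV h"
  shows "set_integrable lborel {0..b} (\<lambda>x. h (C x))"
proof -
  have [measurable]: "h \<in> borel_measurable borel"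
    using assms by (rule borel_measurable_continuous_onI)
  obtain K where K: "\<forall>t\<in>h ` {0..1}. norm t \<le> K"
    using compact_imp_bounded[OF compact_continuous_image[OF continuous_on_subset[OF assms subset_UNIV] compact_Icc]]
    unfolding bounded_iff by blast
  show ?thesis
    unfolding set_integrable_def real_scaleR_def
  proof (rule integrableI_bounded_set[where A = "{0..b}" and B = K])
    show "emeasure lborel {0..b} < \<infinity>" by (cases "0 \<le> b") auto
    show "AE x in lborel. x \<in> {0..b} \<longrightarrow> norm (indicator {0..b} x * h (C x)) \<le> K"
      using K cdf_nonneg cdf_bounded_prob by (auto simp: indicator_def)
  qed auto
qed

section \<open>The bound by the standard deviation\<close>

text \<open>
  Reflection \<open>x \<mapsto> b - x\<close> exchanges \<open>C x\<close> and \<open>1 - C x\<close>. The integrand and its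
  reflection add up to \<open>1 - C x ^ (n + 1) - (1 - C x) ^ (n + 1)\<close>, whose derivative in \<open>C x\<close> is odd
  about \<open>1 / 2\<close>: symmetry removes from the weight \<open>u ^ n\<close> the part that is even about \<open>1 / 2\<close>,
  which makes the later use of the Cauchy-Schwarz inequality sharper.
\<close>

lemma integral_cdf_gap_reflect:
  assumes supp: "\<And>x. x < 0 \<Longrightarrow> C x = 0" "C b = 1"
    and sym: "\<And>x. C (b - x) = 1 - C x"
  shows "2 * (LBINT x:{0..b}. C x - C x ^ (n + 1)) =
         real (n + 1) * (\<integral>u. (u ^ n - (1 - u) ^ n) * I u \<partial>unit_uniform)"
proof -
  define g where "g u = real (n + 1) * (u ^ n - (1 - u) ^ n)" for u :: real
  have cont: "continuous_on {0..1} g"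
    unfolding g_def by (intro continuous_intros)
  have deriv: "((\<lambda>u. u ^ (n + 1) + (1 - u) ^ (n + 1)) has_real_derivative g u) (at u)" for u
    unfolding g_def
    by (rule derivative_eq_intros refl | simp del: of_nat_Suc of_nat_add add: algebra_simps)+
  have "(LBINT x:{0..b}. C x - C x ^ (n + 1))
      = (\<integral>x. indicator {0..b} (b - x) * (C (b - x) - C (b - x) ^ (n + 1)) \<partial>lborel)"
    unfolding set_lebesgue_integral_def by (subst lborel_integral_real_affine[of "-1" _ b]) auto
  also have "\<dots> = (LBINT x:{0..b}. (1 - C x) - (1 - C x) ^ (n + 1))"
    unfolding set_lebesgue_integral_def sym
    by (intro Bochner_Integration.integral_cong) (auto simp: indicator_def)
  finally have "2 * (LBINT x:{0..b}. C x - C x ^ (n + 1)) =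
      (LBINT x:{0..b}. C x - C x ^ (n + 1)) + (LBINT x:{0..b}. (1 - C x) - (1 - C x) ^ (n + 1))"
    by simp
  also have "\<dots> = (LBINT x:{0..b}. (C x - C x ^ (n + 1)) + ((1 - C x) - (1 - C x) ^ (n + 1)))"
    by (intro set_integral_add(2)[symmetric] set_integrable_cdf continuous_intros
         set_integrable_cdf[where h = "\<lambda>t. t - t ^ (n + 1)"]
         set_integrable_cdf[where h = "\<lambda>t. (1 - t) - (1 - t) ^ (n + 1)"])
  also have "\<dots> = (LBINT x:{0..b}. (\<integral>u. indicator {C x<..} u * g u \<partial>unit_uniform))"
  proof -
    have "C x - C x ^ (n + 1) + ((1 - C x) - (1 - C x) ^ (n + 1))
        = (\<integral>u. indicator {C x<..} u * g u \<partial>unit_uniform)" for x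
      using unit_uniform_tail_integral[OF cdf_nonneg cdf_bounded_prob deriv cont, of x] by simp
    then show ?thesis by presburger
  qed
  also have "\<dots> = (\<integral>u. g u * I u \<partial>unit_uniform)"
    by (rule integral_tail_eq_quantile[OF supp cont])
  also have "\<dots> = real (n + 1) * (\<integral>u. (u ^ n - (1 - u) ^ n) * I u \<partial>unit_uniform)"
    by (simp add: g_def mult.assoc del: of_nat_Suc of_nat_add)
  finally show ?thesis .
qed

text \<open>
  The weight \<open>u ^ n - (1 - u) ^ n\<close> has mean zero, so the quantile function may be centred before the
  Cauchy-Schwarz inequality is applied. Since \<open>I\<close> has the given distribution, \<open>s\<close> is the standard
  deviation when \<open>m\<close> is the mean.
\<close>

lemma integral_cdf_gap_le:
  assumes supp: "\<And>x. x < 0 \<Longrightarrow> C x = 0" "C b = 1"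
    and sym: "\<And>x. C (b - x) = 1 - C x"
    and s: "s > 0" "(\<integral>u. (I u - m)\<^sup>2 \<partial>unit_uniform) = s\<^sup>2"
    and n: "n > 0"
  shows "(LBINT x:{0..b}. C x - C x ^ (n + 1)) \<le> real (n + 1) * (s / 2 * c (n + 1))"
proof -
  interpret U: prob_space unit_uniform by (rule prob_space_unit_uniform)
  define g where "g u = u ^ n - (1 - u) ^ n" for u :: real
  have [measurable]: "(\<lambda>x. x) \<in> borel_measurable unit_uniform"
    by (simp add: measurable_restrict_space1)
  have g [measurable]: "g \<in> borel_measurable unit_uniform"
    unfolding g_def by measurable
  have g_bd: "\<bar>g u\<bar> \<le> 1" if "0 < u" "u < 1" for u
    using that power_le_one[of u n] power_le_one[of "1 - u" n] zero_le_power[of u n] zero_le_power[of "1 - u" n]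
    unfolding g_def abs_le_iff by linarith
  have I_bd: "\<bar>I u - m\<bar> \<le> b + \<bar>m\<bar>" if "0 < u" "u < 1" for u
    using quantile_bounds[OF supp that] by linarith
  have bounded: "integrable unit_uniform f"
    if "f \<in> borel_measurable unit_uniform" "\<And>u. 0 < u \<Longrightarrow> u < 1 \<Longrightarrow> \<bar>f u\<bar> \<le> K" for f :: "real \<Rightarrow> real" and K
    using that by (intro U.integrable_const_bound[of _ K]) (auto simp: space_restrict_space)
  have int_g: "integrable unit_uniform g"
    by (rule bounded[OF _ g_bd]) auto
  have int_gI: "integrable unit_uniform (\<lambda>u. (I u - m) * g u)"
  proof (rule bounded)
    fix u :: real assume u: "0 < u" "u < 1"
    show "\<bar>(I u - m) * g u\<bar> \<le> (b + \<bar>m\<bar>) * 1"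
      unfolding abs_mult using I_bd[OF u] g_bd[OF u] by (intro mult_mono) auto
  qed measurable
  have int_g2: "integrable unit_uniform (\<lambda>u. (g u)\<^sup>2)"
  proof (rule bounded)
    fix u :: real assume u: "0 < u" "u < 1"
    show "\<bar>(g u)\<^sup>2\<bar> \<le> 1" using g_bd[OF u] by (simp add: abs_square_le_1)
  qed measurable
  have int_I2: "integrable unit_uniform (\<lambda>u. (I u - m)\<^sup>2)"
  proof (rule bounded)
    fix u :: real assume u: "0 < u" "u < 1"
    show "\<bar>(I u - m)\<^sup>2\<bar> \<le> (b + \<bar>m\<bar>)\<^sup>2" using I_bd[OF u] power_mono[of "\<bar>I u - m\<bar>" _ 2] by simp
  qed measurable
  have g_mean: "(\<integral>u. g u \<partial>unit_uniform) = 0"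
  proof -
    have "((\<lambda>u. (u ^ (n + 1) + (1 - u) ^ (n + 1)) / real (n + 1)) has_real_derivative g u) (at u)" for u
      unfolding g_def
      by (rule derivative_eq_intros refl | simp del: of_nat_Suc of_nat_add add: field_simps)+
    moreover have "continuous_on {0..1} g" unfolding g_def by (intro continuous_intros)
    ultimately have "(\<integral>u. indicator {0<..} u * g u \<partial>unit_uniform) = 0"
      using unit_uniform_tail_integral[of 0 _ g] by fastforce
    moreover have "(\<integral>u. indicator {0<..} u * g u \<partial>unit_uniform) = (\<integral>u. g u \<partial>unit_uniform)"
      by (intro Bochner_Integration.integral_cong) (auto simp: space_restrict_space)
    ultimately show ?thesis by simp
  qed
  have "(\<integral>u. g u * I u \<partial>unit_uniform) = (\<integral>u. (I u - m) * g u + m * g u \<partial>unit_uniform)"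
    by (simp add: algebra_simps)
  also have "\<dots> = (\<integral>u. (I u - m) * g u \<partial>unit_uniform)"
    using int_gI int_g g_mean by simp
  also have "\<dots> \<le> s * c (n + 1)"
    using integral_square_difference_eq_c[OF n] c_pos[of "n + 1"] n s
    by (intro Cauchy_Schwarz_integral int_I2 int_g2 int_gI) (auto simp: g_def)
  finally have "real (n + 1) * (\<integral>u. g u * I u \<partial>unit_uniform) \<le> real (n + 1) * (s * c (n + 1))"
    by (intro mult_left_mono) auto
  then show ?thesis
    using integral_cdf_gap_reflect[OF supp sym, of n] unfolding g_def[symmetric] by linarith
qed

section \<open>The entropy bound\<close>

lemma entropy_sums:
  assumes supp: "\<And>x. x < 0 \<Longrightarrow> C x = 0" "C b = 1"
  shows "(\<lambda>k. (LBINT x:{0..b}. C x - C x ^ (k + 2)) / (real (k + 1) * real (k + 2)))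
           sums - (LBINT x:{0..}. (1 - C x) * ln (1 - C x))"
proof -
  define f where "f k x = indicator {0..b} x * ((C x - C x ^ (k + 2)) / (real (k + 1) * real (k + 2)))" for k x
  have C01: "0 \<le> C x" "C x \<le> 1" for x
    by (auto simp: cdf_nonneg cdf_bounded_prob)
  have C1: "C x = 1" if "x > b" for x
    using cdf_nondecreasing[of b x] that supp(2) C01(2)[of x] by simp
  have "b \<ge> 0"
    using supp by (cases "b < 0") auto
  have f_nonneg: "0 \<le> f k x" for k x
    using C01[of x] power_decreasing[of 1 "k + 2" "C x"] by (simp add: f_def)
  have f_sums: "(\<lambda>k. f k x) sums (indicator {0..b} x * - ((1 - C x) * ln (1 - C x)))" for x
    unfolding f_def by (intro sums_mult entropy_series C01)
  have int_f: "integrable lborel (f k)" for k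
    using set_integrable_cdf[of "\<lambda>t. (t - t ^ (k + 2)) / (real (k + 1) * real (k + 2))" b]
    unfolding f_def set_integrable_def by (simp add: continuous_intros)
  have int_eq: "(\<integral>x. f k x \<partial>lborel) = (LBINT x:{0..b}. C x - C x ^ (k + 2)) / (real (k + 1) * real (k + 2))" for k
    unfolding f_def set_lebesgue_integral_def
    by (simp del: of_nat_Suc of_nat_add integral_divide_zero flip: integral_divide_zero)
  have "summable (\<lambda>k. \<integral>x. norm (f k x) \<partial>lborel)"
  proof (rule summable_comparison_test')
    show "summable (\<lambda>k. b * (1 / (real (k + 1) * real (k + 2))))"
      by (intro summable_mult sums_summable[OF sums_inverse_consecutive])
    fix k :: nat
    have "(\<integral>x. norm (f k x) \<partial>lborel) \<le> (\<integral>x. indicator {0..b} x * (1 / (real (k + 1) * real (k + 2))) \<partial>lborel)"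
    proof (rule integral_mono)
      fix x
      have "C x - C x ^ (k + 2) \<le> 1"
        using C01[of x] zero_le_power[of "C x" "k + 2"] by linarith
      then have "f k x \<le> indicator {0..b} x * (1 / (real (k + 1) * real (k + 2)))"
        unfolding f_def by (intro mult_left_mono divide_right_mono) auto
      then show "norm (f k x) \<le> indicator {0..b} x * (1 / (real (k + 1) * real (k + 2)))"
        using f_nonneg[of k x] by simp
    qed (use int_f \<open>b \<ge> 0\<close> in auto)
    also have "\<dots> = b * (1 / (real (k + 1) * real (k + 2)))"
      using \<open>b \<ge> 0\<close> by simp
    finally show "norm (\<integral>x. norm (f k x) \<partial>lborel) \<le> b * (1 / (real (k + 1) * real (k + 2)))"
      by simp
  qed
  moreover have "summable (\<lambda>k. norm (f k x))" for x
    using f_sums[of x] f_nonneg by (simp add: sums_iff)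
  ultimately have "(\<lambda>k. \<integral>x. f k x \<partial>lborel) sums (\<integral>x. (\<Sum>k. f k x) \<partial>lborel)"
    by (intro sums_integral int_f) auto
  also have "(\<integral>x. (\<Sum>k. f k x) \<partial>lborel) = - (LBINT x:{0..}. (1 - C x) * ln (1 - C x))"
    unfolding set_lebesgue_integral_def Bochner_Integration.integral_minus[symmetric]
    using f_sums C1 by (intro Bochner_Integration.integral_cong) (auto simp: sums_iff indicator_def not_le)
  finally show ?thesis
    unfolding int_eq .
qed

end

theorem theorem3:
  fixes M :: "'a measure" and X :: "'a \<Rightarrow> real" and \<mu> \<sigma> :: real
  assumes "prob_space M"
    and "X \<in> borel_measurable M"
    and "AE \<omega> in M. 0 \<le> X \<omega>"
    and "absolutely_continuous lborel (distr M borel X)"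
    and "bounded (measure_support (distr M borel X))"
    and "prob_space.expectation M X = \<mu>"
    and "prob_space.variance M X = \<sigma>\<^sup>2"
    and "\<sigma> > 0"
    and "symmetric_about M X \<mu>"
  shows "cumulative_residual_entropy M X
           \<le> \<sigma> / 2 * (\<Sum>k. c (Suc k + 1) / real (Suc k))"
proof -
  interpret M: prob_space M by fact
  note X [measurable] = \<open>X \<in> borel_measurable M\<close>
  let ?N = "distr M borel X"
  interpret N: cdf_distribution ?N
    unfolding cdf_distribution_def by (rule M.real_distribution_distr) fact
  have cdf_eq: "N.C x = M.prob {\<omega> \<in> space M. X \<omega> \<le> x}" for x
    by (simp add: cdf_def measure_distr vimage_def Int_def conj_commute)
  have no_atoms: "AE \<omega> in M. X \<omega> \<noteq> x" for x
  proof -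
    have "{x} \<in> null_sets ?N"
      using \<open>absolutely_continuous lborel ?N\<close> finite_imp_null_set_lborel[of "{x}"]
      unfolding absolutely_continuous_def by blast
    then have "AE y in ?N. y \<noteq> x"
      using AE_not_in by force
    then show ?thesis by (simp add: AE_distr_iff)
  qed
  \<comment> \<open>The absence of atoms gives the value \<open>0\<close> at \<open>0\<close> itself, and hence the value \<open>1\<close> at the
    reflected point.\<close>
  have nonpos: "N.C x = 0" if "x \<le> 0" for x
  proof -
    have "AE \<omega> in M. \<not> X \<omega> \<le> x"
      using \<open>AE \<omega> in M. 0 \<le> X \<omega>\<close> no_atoms[of 0] by eventually_elim (use that in auto)
    then show ?thesis
      unfolding cdf_eq by (subst M.prob_eq_0) auto
  qed
  have sym: "N.C (2 * \<mu> - x) = 1 - N.C x" for x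
  proof -
    have "N.C (2 * \<mu> - x) = measure (distr M borel (\<lambda>\<omega>. X \<omega> - \<mu>)) {..\<mu> - x}"
      unfolding cdf_eq by (subst measure_distr) (auto intro!: arg_cong[where f = M.prob])
    also have "\<dots> = measure (distr M borel (\<lambda>\<omega>. \<mu> - X \<omega>)) {..\<mu> - x}"
      using \<open>symmetric_about M X \<mu>\<close> by (simp add: symmetric_about_def)
    also have "\<dots> = M.prob {\<omega> \<in> space M. x \<le> X \<omega>}"
      by (subst measure_distr) (auto intro!: arg_cong[where f = M.prob])
    also have "\<dots> = M.prob {\<omega> \<in> space M. \<not> X \<omega> \<le> x}"
      using no_atoms[of x] by (intro M.finite_measure_eq_AE) auto
    also have "\<dots> = 1 - N.C x"
      unfolding cdf_eq by (subst M.prob_neg) auto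
    finally show ?thesis .
  qed
  have top: "N.C (2 * \<mu>) = 1"
    using sym[of 0] nonpos[of 0] by simp
  have var: "(\<integral>u. (N.I u - \<mu>)\<^sup>2 \<partial>unit_uniform) = \<sigma>\<^sup>2"
  proof -
    have "(\<integral>u. (N.I u - \<mu>)\<^sup>2 \<partial>unit_uniform) = (\<integral>x. (x - \<mu>)\<^sup>2 \<partial>distr unit_uniform borel N.I)"
      by (subst integral_distr) auto
    also have "\<dots> = (\<integral>\<omega>. (X \<omega> - \<mu>)\<^sup>2 \<partial>M)"
      unfolding N.distr_I_eq_M by (subst integral_distr) auto
    finally show ?thesis
      using \<open>M.expectation X = \<mu>\<close> \<open>M.variance X = \<sigma>\<^sup>2\<close> by simp
  qed
  note series = N.entropy_sums[OF nonpos[OF less_imp_le] top]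
  have "(LBINT x:{0..2 * \<mu>}. N.C x - N.C x ^ (k + 2)) / (real (k + 1) * real (k + 2))
      \<le> \<sigma> / 2 * (c (Suc k + 1) / real (Suc k))" for k
  proof -
    have "(LBINT x:{0..2 * \<mu>}. N.C x - N.C x ^ (k + 2)) \<le> real (k + 2) * (\<sigma> / 2 * c (Suc k + 1))"
      using N.integral_cdf_gap_le[OF nonpos[OF less_imp_le] top sym \<open>\<sigma> > 0\<close> var, of "Suc k"] by simp
    then have "(LBINT x:{0..2 * \<mu>}. N.C x - N.C x ^ (k + 2)) / (real (k + 1) * real (k + 2))
        \<le> real (k + 2) * (\<sigma> / 2 * c (Suc k + 1)) / (real (k + 1) * real (k + 2))"
      by (intro divide_right_mono) auto
    also have "\<dots> = \<sigma> / 2 * (c (Suc k + 1) / real (Suc k))"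
      by (simp add: divide_simps)
    finally show ?thesis .
  qed
  then have "- (LBINT x:{0..}. (1 - N.C x) * ln (1 - N.C x)) \<le> (\<Sum>k. \<sigma> / 2 * (c (Suc k + 1) / real (Suc k)))"
    by (intro sums_le[OF _ series summable_sums[OF summable_mult[OF summable_c]]])
  then show ?thesis
    unfolding cumulative_residual_entropy_def by (simp only: suminf_mult[OF summable_c])
qed

end
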